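(* There exists a 2-dimensional word $\mathbf{w}$ over a $9$-letter alphabet such that every line of $\mathbf{w}$ is $2^+$-power-free (overlapfree).
   Context: A 2-dimensional word over a finite alphabet $A$ is a map $\mathbf{w}: \mathbb{N}^2 \to A$, where $\mathbb{N}=\{0,1,2,\ldots\}$; write $w_{m,n} = \mathbf{w}(m,n)$. An infinite word $\mathbf{x}=x_0x_1x_2\cdots$ is a line of $\mathbf{w}$ if there exist integers $i_1,i_2,j_1,j_2$ with $\gcd(j_1,j_2)=1$ such that $x_t = w_{i_1+j_1t,\,i_2+j_2t}$ for all $t \geq 0$ (in particular all these indices lie in $\mathbb{N}$). For a positive rational $q$, a $q$-power is a non-empty word $x^kx'$, where $k\ge 0$ is an integer, $x'$ is a prefix of $x$ and $|x^kx'|/|x| = q$. A word is $2^+$-power-free (overlapfree) if no contiguous block of it is a $q$-power with $q > 2$. *)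

theory Defs
  imports Complex_Main "HOL-Library.Sublist"
begin

type_synonym 'a word2 = "nat \<times> nat \<Rightarrow> 'a"

definition word2_over :: "'a set \<Rightarrow> 'a word2 \<Rightarrow> bool" where
  "word2_over A w \<longleftrightarrow> range w \<subseteq> A"

(* The offsets and the direction are integers; the two nonnegativity conditions make the
   conversion to natural-number indices exact. *)
definition line_of :: "'a word2 \<Rightarrow> (nat \<Rightarrow> 'a) \<Rightarrow> bool" where
  "line_of w x \<longleftrightarrow> (\<exists>i1 i2 j1 j2 :: int. gcd j1 j2 = 1 \<and>
     (\<forall>t::nat. i1 + j1 * int t \<ge> 0 \<and> i2 + j2 * int t \<ge> 0 \<and>
        x t = w (nat (i1 + j1 * int t), nat (i2 + j2 * int t))))"

definition block_of :: "'a list \<Rightarrow> (nat \<Rightarrow> 'a) \<Rightarrow> bool" where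
  "block_of u x \<longleftrightarrow> (\<exists>i n. u = map x [i..<i + n])"

(* The word u is non-empty, so the base x is non-empty too and the quotient of lengths
   is never a division by zero. *)
definition is_power :: "rat \<Rightarrow> 'a list \<Rightarrow> bool" where
  "is_power q u \<longleftrightarrow> q > 0 \<and> u \<noteq> [] \<and>
     (\<exists>x k x'. u = concat (replicate k x) @ x' \<and> prefix x' x \<and>
        of_nat (length u) / of_nat (length x) = q)"

definition plus_power_free :: "rat \<Rightarrow> (nat \<Rightarrow> 'a) \<Rightarrow> bool" where
  "plus_power_free p x \<longleftrightarrow> \<not> (\<exists>u q. block_of u x \<and> q > p \<and> is_power q u)"

abbreviation overlapfree :: "(nat \<Rightarrow> 'a) \<Rightarrow> bool" where
  "overlapfree \<equiv> plus_power_free 2"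

end

theory Submission
  imports Defs
begin

text \<open>
  The plan is to find a word over three letters all of whose subsequences along arithmetic
  progressions with odd difference are overlapfree, and to let the two coordinates of \<open>w (m, n)\<close>
  be the letters of that word at \<open>m\<close> and at \<open>n\<close>. Along a line in direction \<open>(j1, j2)\<close> the two
  coordinates run through progressions with differences \<open>j1\<close> and \<open>j2\<close>. These are coprime, so one
  of them is odd, and a repetition along the line is a repetition in that coordinate as well.

  The ternary word refines the regular paperfolding word, whose entry at \<open>2 ^ k * m\<close> with \<open>m\<close> odd
  tells whether \<open>m\<close> is 1 or 3 modulo 4. In addition, the ternary word uses a different pair of
  letters in each of the cases \<open>k = 0\<close>, \<open>k = 1\<close> and \<open>k \<ge> 2\<close>, namely 0 and 1, 0 and 2, 1 and 2.
  Index 0, divisible by all powers of 2, belongs to the third case.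

  Suppose that an overlap of period \<open>p\<close> occurs along a progression with odd difference.
  If \<open>p\<close> is even, say \<open>p = 2 ^ s * p'\<close> with \<open>p'\<close> odd, then some index among the first \<open>p\<close> has
  2-adic valuation \<open>s - 1\<close>. Moving by one period preserves this valuation and adds 2 to the
  odd part modulo 4, so the letter changes (\<open>turn_changes_after_even_period\<close>).
  If \<open>p\<close> is odd, then a period exchanges even and odd indices. When the first index is odd,
  the first and the last letter of the overlap should agree with each other, but their indices are
  odd and differ by 2 modulo 4. When it is even, every letter at an even index would have to
  be one of the letters 0 and 1 that occur at odd indices. For \<open>p \<ge> 3\<close> this is violated by an
  index that is 6 modulo 8, which carries the letter 2. For \<open>p = 1\<close> the three letters would be
  the same and come from all three pairs, but no letter belongs to all of them.
\<close>

section \<open>Overlaps\<close>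

text \<open>If \<open>u\<close> is a power of \<open>v\<close>, then \<open>u\<close> is a prefix of \<open>v @ u\<close>; comparing the two letter by letter
  shows that \<open>u\<close> has the period \<open>length v\<close>.\<close>

lemma nth_power_periodic:
  assumes u: "u = concat (replicate k v) @ v'" and pre: "prefix v' v"
    and len: "t + length v < length u"
  shows "u ! (t + length v) = u ! t"
proof -
  obtain z where z: "v = v' @ z"
    using pre by (auto simp: prefix_def)
  have "v @ concat (replicate k v) = concat (replicate k v) @ v"
    by (induction k) auto
  then have "v @ u = concat (replicate k v) @ v @ v'"
    unfolding u by (metis append.assoc)
  also have "\<dots> = u @ z @ v'"
    unfolding u using z by simp
  finally have "(v @ u) ! (t + length v) = u ! (t + length v)"
    using len by (simp add: nth_append)
  then show ?thesis
    by (simp add: nth_append)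
qed

lemma overlapfreeI:
  assumes "\<And>i p. p > 0 \<Longrightarrow> \<exists>t\<le>p. x (i + t) \<noteq> x (i + (t + p))"
  shows "overlapfree x"
  unfolding plus_power_free_def
proof (rule notI, elim exE conjE)
  fix u q
  assume "block_of u x" and q: "q > (2::rat)" and "is_power q u"
  then obtain i n v k v' where u: "u = map x [i..<i + n]"
    and v: "u = concat (replicate k v) @ v'" "prefix v' v"
    and quot: "of_nat (length u) / of_nat (length v) = q"
    unfolding block_of_def is_power_def by blast
  have "length v > 0"
    using quot q by (cases "length v = 0") auto
  moreover have "(of_nat (length u) :: rat) > of_nat (2 * length v)"
    using quot q \<open>length v > 0\<close> by (auto simp: field_simps)
  then have n: "n > 2 * length v"
    unfolding of_nat_less_iff by (simp add: u)
  moreover obtain t where t: "t \<le> length v" "x (i + t) \<noteq> x (i + (t + length v))"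
    using assms \<open>length v > 0\<close> by blast
  ultimately have "u ! (t + length v) = u ! t"
    by (intro nth_power_periodic[OF v]) (simp add: u)
  then show False
    using t n by (simp add: u)
qed

section \<open>Paperfolding along arithmetic progressions\<close>

text \<open>This is the regular paperfolding word, defined for all indices by \<open>turn 0 = False\<close>.\<close>

function turn :: "nat \<Rightarrow> bool" where
  "turn n = (if even n \<and> n > 0 then turn (n div 2) else n mod 4 = 3)"
  by auto
termination by (relation "measure id") auto

declare turn.simps [simp del]

lemma turn_double: "turn (2 * n) = turn n"
  by (cases "n = 0") (simp_all add: turn.simps[of "2 * n"])

lemma turn_odd: "odd n \<Longrightarrow> turn n \<longleftrightarrow> n mod 4 = 3"
  by (simp add: turn.simps[of n])

lemma turn_odd_add:
  assumes "odd n" "c mod 4 = 2"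
  shows "turn (n + c) \<noteq> turn n"
proof -
  have "odd (n + c)" "(n + c) mod 4 = 3 \<longleftrightarrow> n mod 4 \<noteq> 3"
    using assms by presburger+
  then show ?thesis
    using assms by (simp add: turn_odd)
qed

lemma odd_mult_mod4:
  fixes d p :: nat
  assumes "odd d" "p mod 4 = 2"
  shows "d * p mod 4 = 2"
proof -
  obtain e where e: "d = 2 * e + 1"
    using assms(1) by (elim oddE)
  obtain q where q: "p = 4 * q + 2"
    using assms(2) by (metis mult_div_mod_eq)
  have "d * p = 4 * (d * q + e) + 2"
    unfolding e q by (simp add: algebra_simps)
  then show ?thesis
    by presburger
qed

lemma turn_changes_after_odd_index:
  assumes "odd d" "p mod 4 = 2" "odd (a + d * t)"
  shows "turn (a + d * (t + p)) \<noteq> turn (a + d * t)"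
  using turn_odd_add[OF assms(3) odd_mult_mod4[OF assms(1,2)]] by (simp add: algebra_simps)

text \<open>The even indices of the progression, halved, form a progression with the same difference,
  and \<open>turn\<close> does not see the halving. So a period divisible by 4 can be halved until it
  is 2 modulo 4, and then it changes \<open>turn\<close> at every odd index.\<close>

lemma turn_changes_after_even_period:
  assumes "odd d" "even p" "p > 0"
  shows "\<exists>t<p. turn (a + d * (t + p)) \<noteq> turn (a + d * t)"
  using assms(2,3)
proof (induction p arbitrary: a rule: less_induct)
  case (less p)
  show ?case
  proof (cases "p mod 4 = 2")
    case True
    obtain t where "t < 2" "odd (a + d * t)"
      using \<open>odd d\<close> that[of 0] that[of 1] by auto
    moreover have "2 \<le> p"
      using True by (cases "p < 2") auto
    ultimately show ?thesis
      using turn_changes_after_odd_index[OF \<open>odd d\<close> True] by (intro exI[of _ t]) auto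
  next
    case False
    define r where "r = p div 2"
    have r: "p = 2 * r" "even r" "r > 0"
      using False less.prems unfolding r_def by presburger+
    obtain t0 where t0: "t0 < 2" "even (a + d * t0)"
      using \<open>odd d\<close> that[of 0] that[of 1] by auto
    then obtain b where b: "a + d * t0 = 2 * b"
      by (elim evenE)
    obtain t where t: "t < r" "turn (b + d * (t + r)) \<noteq> turn (b + d * t)"
      using less.IH[of r b] r by auto
    have "a + d * (t0 + 2 * t) = 2 * (b + d * t)"
      and "a + d * (t0 + 2 * t + p) = 2 * (b + d * (t + r))"
      using b by (simp_all add: r(1) algebra_simps)
    then have "turn (a + d * (t0 + 2 * t + p)) \<noteq> turn (a + d * (t0 + 2 * t))"
      using t(2) by (simp only: turn_double not_False_eq_True)
    moreover have "t0 + 2 * t < p"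
      using t0(1) t(1) r(1) by linarith
    ultimately show ?thesis
      by blast
  qed
qed

section \<open>A ternary word without overlaps in odd progressions\<close>

definition letter :: "nat \<Rightarrow> nat" where
  "letter n =
     (if odd n then (if turn n then 1 else 0)
      else if n mod 4 = 2 then (if turn n then 2 else 0)
      else (if turn n then 2 else 1))"

lemma letter_less: "letter n < 3"
  by (simp add: letter_def)

lemma letter_odd_index: "odd n \<Longrightarrow> letter n < 2"
  by (simp add: letter_def)

text \<open>The hypothesis puts \<open>m\<close> and \<open>n\<close> into the same of the three cases in the definition of
  \<open>letter\<close>, where \<open>turn\<close> alone selects the letter.\<close>

lemma letter_eq_imp_turn_eq:
  assumes "letter m = letter n" "m mod 4 = n mod 4 \<or> odd m \<and> odd n"
  shows "turn m = turn n"
proof (cases "odd m")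
  case True
  then have "odd n"
    using assms(2) by presburger
  then show ?thesis
    using assms(1) True by (auto simp: letter_def split: if_splits)
next
  case False
  then have "m mod 4 = n mod 4" "even n"
    using assms(2) by presburger+
  then show ?thesis
    using assms(1) False by (auto simp: letter_def split: if_splits)
qed

lemma letter_6_mod_8:
  assumes "n mod 8 = 6"
  shows "letter n = 2"
proof -
  define h where "h = n div 2"
  have h: "n = 2 * h" "odd h" "h mod 4 = 3" "n mod 4 = 2"
    using assms unfolding h_def by presburger+
  then have "turn n"
    by (simp add: turn_double turn_odd)
  then show ?thesis
    using h by (simp add: letter_def)
qed

text \<open>Turns can be compared through letters at indices in the same case of \<open>letter\<close>: a period
  divisible by 4 preserves the index modulo 4, and otherwise an odd index serves.\<close>

lemma letter_no_overlap_even_period: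
  assumes d: "odd d" and p: "even p" "p > 0"
  shows "\<exists>t\<le>p. letter (a + d * t) \<noteq> letter (a + d * (t + p))"
proof (cases "p mod 4 = 2")
  case True
  obtain t where t: "t < 2" "odd (a + d * t)"
    using d that[of 0] that[of 1] by auto
  moreover have "odd (a + d * (t + p))"
    using t(2) p(1) by (simp add: distrib_left)
  ultimately have "letter (a + d * t) \<noteq> letter (a + d * (t + p))"
    using turn_changes_after_odd_index[OF d True t(2)] letter_eq_imp_turn_eq by metis
  moreover have "t \<le> p"
    using t(1) p by (cases "p < 2") auto
  ultimately show ?thesis
    by blast
next
  case False
  then have "4 dvd p"
    using p(1) by presburger
  obtain t where t: "t < p" "turn (a + d * (t + p)) \<noteq> turn (a + d * t)"
    using turn_changes_after_even_period[OF d p] by blast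
  obtain r where "p = 4 * r"
    using \<open>4 dvd p\<close> by (elim dvdE)
  then have "a + d * (t + p) = a + d * t + 4 * (d * r)"
    by (simp add: algebra_simps)
  then have "(a + d * (t + p)) mod 4 = (a + d * t) mod 4"
    by (simp only: mod_mult_self2)
  then have "letter (a + d * t) \<noteq> letter (a + d * (t + p))"
    using t(2) letter_eq_imp_turn_eq by metis
  then show ?thesis
    using t(1) by (intro exI[of _ t]) simp
qed

text \<open>As \<open>2 * d\<close> is 2 or 6 modulo 8, the indices \<open>a\<close>, \<open>a + 2 * d\<close>, \<open>a + 4 * d\<close> and
  \<open>a + 6 * d\<close> run through all even residues.\<close>

lemma odd_progression_meets_6_mod_8:
  fixes a d :: nat
  assumes "even a" "odd d"
  obtains t where "even t" "t \<le> 6" "(a + d * t) mod 8 = 6"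
proof -
  define r u where "r = a mod 8" and "u = d mod 8"
  have residue: "(a + d * t) mod 8 = (r + u * t) mod 8" for t
    unfolding r_def u_def by (metis mod_add_cong mod_mod_trivial mod_mult_left_eq)
  have "r \<in> {0, 2, 4, 6}"
  proof -
    have "even r" "r < 8"
      using assms(1) by (simp_all add: r_def dvd_mod_iff)
    then show ?thesis
      unfolding insert_iff empty_iff by presburger
  qed
  moreover have "u \<in> {1, 3, 5, 7}"
  proof -
    have "odd u" "u < 8"
      using assms(2) by (simp_all add: u_def dvd_mod_iff)
    then show ?thesis
      unfolding insert_iff empty_iff by presburger
  qed
  ultimately have "\<exists>t\<in>{0, 2, 4, 6}. (r + u * t) mod 8 = 6"
    by auto
  then show thesis
    unfolding residue[symmetric] by (elim bexE) (rule that, auto)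
qed

lemma letter_no_overlap_odd_period:
  assumes d: "odd d" and p: "odd p"
  shows "\<exists>t\<le>p. letter (a + d * t) \<noteq> letter (a + d * (t + p))"
proof (rule ccontr)
  assume "\<not> ?thesis"
  then have eq: "letter (a + d * t) = letter (a + d * (t + p))" if "t \<le> p" for t
    using that by blast
  show False
  proof (cases "odd a")
    case True
    (* The first, the middle and the last letter agree, but the first and the last index are
       odd and differ by 2 modulo 4. *)
    have "2 * p mod 4 = 2"
      using p by presburger
    then have "turn (a + d * (0 + 2 * p)) \<noteq> turn (a + d * 0)"
      using True by (intro turn_changes_after_odd_index d) auto
    moreover have "letter (a + d * 0) = letter (a + d * (0 + 2 * p))"
      using eq[of 0] eq[of p] by (simp add: mult_2)
    ultimately show False
      using letter_eq_imp_turn_eq[of "a + d * 0" "a + d * (0 + 2 * p)"] True by simp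
  next
    case False
    (* Every letter at an even index is repeated, one period later or earlier, at an odd index. *)
    have even_index: "letter (a + d * t) < 2" if "even t" "t \<le> 2 * p" for t
    proof (cases "t \<le> p")
      case True
      have "odd (a + d * (t + p))"
        using False d p that by simp
      then show ?thesis
        using eq[OF True] letter_odd_index by simp
    next
      case greater: False
      have "odd (a + d * (t - p))"
        using False d p that greater by simp
      moreover have "letter (a + d * (t - p)) = letter (a + d * t)"
        using eq[of "t - p"] that greater by simp
      ultimately show ?thesis
        using letter_odd_index by metis
    qed
    show False
    proof (cases "p = 1")
      case True
      have "letter a = letter (a + d)" "letter (a + d) = letter (a + 2 * d)"
        using eq[of 0] eq[of 1] by (simp_all add: True mult_2 mult_2_right)
      moreover obtain b e where "a = 2 * b" "d = 2 * e + 1"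
        using d False by (elim evenE oddE) blast
      then have "odd (a + d)" "even (a + 2 * d)" "(a + 2 * d) mod 4 = 2 \<longleftrightarrow> a mod 4 \<noteq> 2"
        by presburger+
      ultimately show False
        using False by (auto simp: letter_def split: if_splits)
    next
      case not1: False
      obtain t where t: "even t" "t \<le> 6" "(a + d * t) mod 8 = 6"
        using odd_progression_meets_6_mod_8[of a d] False d by blast
      moreover have "6 \<le> 2 * p"
        using p not1 by presburger
      ultimately show False
        using even_index[of t] letter_6_mod_8 by simp
    qed
  qed
qed

lemma letter_no_overlap_odd_progression:
  assumes "odd d" "p > 0"
  shows "\<exists>t\<le>p. letter (a + d * t) \<noteq> letter (a + d * (t + p))"
  using letter_no_overlap_odd_period[of d p a] letter_no_overlap_even_period[of d p a] assms
  by blast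

section \<open>Lines in the quadrant\<close>

lemma nonneg_progression_coeffs:
  fixes i j :: int
  assumes "\<And>t::nat. i + j * int t \<ge> 0"
  shows "i \<ge> 0" "j \<ge> 0"
proof -
  show i: "i \<ge> 0"
    using assms[of 0] by simp
  show "j \<ge> 0"
  proof (rule ccontr)
    assume "\<not> j \<ge> 0"
    then have "j * (i + 1) \<le> - 1 * (i + 1)"
      using i by (intro mult_right_mono) auto
    then show False
      using assms[of "nat (i + 1)"] i by simp
  qed
qed

text \<open>A line never leaves the quadrant, so its direction has no negative component and the line can
  be described by natural numbers. Coprimality keeps the two components from both being even.\<close>

lemma line_of_nat:
  assumes "line_of w x"
  obtains a1 d1 a2 d2 where "odd d1 \<or> odd d2" "\<And>t. x t = w (a1 + d1 * t, a2 + d2 * t)"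
proof -
  obtain i1 i2 j1 j2 where gcd: "gcd j1 j2 = 1"
    and line: "\<forall>t::nat. i1 + j1 * int t \<ge> 0 \<and> i2 + j2 * int t \<ge> 0 \<and>
        x t = w (nat (i1 + j1 * int t), nat (i2 + j2 * int t))"
    using assms unfolding line_of_def by (elim exE conjE)
  then have nonneg: "i1 + j1 * int t \<ge> 0" "i2 + j2 * int t \<ge> 0"
    and x: "x t = w (nat (i1 + j1 * int t), nat (i2 + j2 * int t))" for t
    by simp_all
  note pos = nonneg_progression_coeffs[OF nonneg(1)] nonneg_progression_coeffs[OF nonneg(2)]
  have "odd j1 \<or> odd j2"
    using gcd by (metis gcd_greatest odd_one)
  then have "odd (nat j1) \<or> odd (nat j2)"
    using pos by (simp add: even_nat_iff)
  moreover have "x t = w (nat i1 + nat j1 * t, nat i2 + nat j2 * t)" for t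
    using pos by (simp add: x nat_add_distrib nat_mult_distrib)
  ultimately show thesis
    using that by blast
qed

theorem theorem20:
  shows "\<exists>(A :: nat set) (w :: nat word2). finite A \<and> card A = 9 \<and> word2_over A w \<and>
           (\<forall>x. line_of w x \<longrightarrow> overlapfree x)"
proof -
  (* The two letters are packed into one symbol below 9 as its digits in base 3. *)
  define w :: "nat word2" where "w = (\<lambda>(m, n). letter m + 3 * letter n)"
  have "word2_over {..<9} w"
  proof -
    have "letter m + 3 * letter n < 9" for m n
      using letter_less[of m] letter_less[of n] by linarith
    then show ?thesis
      by (auto simp: word2_over_def w_def)
  qed
  moreover have "overlapfree x" if "line_of w x" for x
  proof (rule overlapfreeI)
    fix i p :: nat
    assume "p > 0"
    obtain a1 d1 a2 d2 where odd: "odd d1 \<or> odd d2"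
      and x: "\<And>t. x t = w (a1 + d1 * t, a2 + d2 * t)"
      using \<open>line_of w x\<close> by (rule line_of_nat) (rule that)
    have digits: "letter m = letter m' \<and> letter n = letter n'" if "w (m, n) = w (m', n')"
      for m n m' n'
    proof -
      have sum: "letter m + 3 * letter n = letter m' + 3 * letter n'"
        using that by (simp add: w_def)
      then have "(letter m + 3 * letter n) mod 3 = (letter m' + 3 * letter n') mod 3"
        by (rule arg_cong)
      then have "letter m = letter m'"
        using letter_less[of m] letter_less[of m'] by simp
      then show ?thesis
        using sum by simp
    qed
    have shift: "a + d * (i + s) = (a + d * i) + d * s" for a d s
      by (simp add: algebra_simps)
    show "\<exists>t\<le>p. x (i + t) \<noteq> x (i + (t + p))"
      using odd
    proof
      assume "odd d1"
      then obtain t where "t \<le> p" "letter (a1 + d1 * (i + t)) \<noteq> letter (a1 + d1 * (i + (t + p)))"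
        using letter_no_overlap_odd_progression[of d1 p "a1 + d1 * i"] \<open>p > 0\<close>
        unfolding shift by blast
      then show ?thesis
        by (intro exI[of _ t]) (auto simp only: x dest: digits)
    next
      assume "odd d2"
      then obtain t where "t \<le> p" "letter (a2 + d2 * (i + t)) \<noteq> letter (a2 + d2 * (i + (t + p)))"
        using letter_no_overlap_odd_progression[of d2 p "a2 + d2 * i"] \<open>p > 0\<close>
        unfolding shift by blast
      then show ?thesis
        by (intro exI[of _ t]) (auto simp only: x dest: digits)
    qed
  qed
  ultimately show ?thesis
    by (intro exI[of _ "{..<9}"] exI[of _ w]) auto
qed

end
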